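(* For a split graph $G$, the following are equivalent: (1) $G$ is an NG-graph; (2) $G$ is an NG-1 graph or an NG-2 graph; (3) $G$ is unbalanced.
   Context: All graphs are finite and simple; $\chi$ is chromatic number, $\omega$ clique number, $\alpha$ independence number, $\overline{G}$ the complement. A graph $G$ is an NG-graph if $\chi(G)+\chi(\overline{G})=|V(G)|+1$. The ABC-partition of $V(G)$ is $A=\{v:\deg(v)=\chi(G)-1\}$, $B=\{v:\deg(v)>\chi(G)-1\}$, $C=\{v:\deg(v)<\chi(G)-1\}$. An NG-graph is NG-1 if $G[A]$ is a clique, NG-2 if $G[A]$ is a stable set. A split graph is one whose vertex set has a KS-partition $V(G)=K\cup S$ (disjoint) with $K$ a clique and $S$ a stable set. A split graph is balanced if it has a KS-partition with $|K|=\omega(G)$ and $|S|=\alpha(G)$, and unbalanced otherwise. *)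

theory Defs
  imports "HOL-Library.Ramsey"
begin

text \<open>
  A graph is given by its vertex set \<open>V\<close> and its set \<open>E\<close> of edges, which are 2-element subsets
  of \<open>V\<close>. Cliques and stable sets are the predicates \<open>clique\<close> and \<open>indep\<close> of HOL-Library.Ramsey;
  these depend only on \<open>E\<close> and do not require the set to lie in \<open>V\<close>. In particular \<open>clique X E\<close> and
  \<open>indep X E\<close>, for \<open>X \<subseteq> V\<close>, say that the induced subgraph on \<open>X\<close> is complete, resp. edgeless.
  The graph without vertices is admitted.
\<close>

definition finite_simple_graph :: "'a set \<Rightarrow> 'a set set \<Rightarrow> bool" where
  "finite_simple_graph V E \<longleftrightarrow> finite V \<and> E \<subseteq> nsets V 2"

definition complement_edges :: "'a set \<Rightarrow> 'a set set \<Rightarrow> 'a set set" where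
  "complement_edges V E = nsets V 2 - E"

definition vertex_degree :: "'a set set \<Rightarrow> 'a \<Rightarrow> nat" where
  "vertex_degree E v = card {e \<in> E. v \<in> e}"

definition proper_colouring :: "'a set \<Rightarrow> 'a set set \<Rightarrow> nat \<Rightarrow> ('a \<Rightarrow> nat) \<Rightarrow> bool" where
  "proper_colouring V E k c \<longleftrightarrow>
     (\<forall>v\<in>V. c v < k) \<and> (\<forall>u\<in>V. \<forall>v\<in>V. {u, v} \<in> E \<longrightarrow> c u \<noteq> c v)"

definition chromatic_number :: "'a set \<Rightarrow> 'a set set \<Rightarrow> nat" where
  "chromatic_number V E = (LEAST k. \<exists>c. proper_colouring V E k c)"

definition clique_number :: "'a set \<Rightarrow> 'a set set \<Rightarrow> nat" where
  "clique_number V E = Max {card K | K. K \<subseteq> V \<and> clique K E}"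

definition independence_number :: "'a set \<Rightarrow> 'a set set \<Rightarrow> nat" where
  "independence_number V E = Max {card S | S. S \<subseteq> V \<and> indep S E}"

definition NG_graph :: "'a set \<Rightarrow> 'a set set \<Rightarrow> bool" where
  "NG_graph V E \<longleftrightarrow>
     chromatic_number V E + chromatic_number V (complement_edges V E) = card V + 1"

text \<open>
  The truncated subtraction below is harmless: a graph with a vertex has chromatic number at least 1.
\<close>

definition ABC_A :: "'a set \<Rightarrow> 'a set set \<Rightarrow> 'a set" where
  "ABC_A V E = {v \<in> V. vertex_degree E v = chromatic_number V E - 1}"

definition ABC_B :: "'a set \<Rightarrow> 'a set set \<Rightarrow> 'a set" where
  "ABC_B V E = {v \<in> V. vertex_degree E v > chromatic_number V E - 1}"

definition ABC_C :: "'a set \<Rightarrow> 'a set set \<Rightarrow> 'a set" where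
  "ABC_C V E = {v \<in> V. vertex_degree E v < chromatic_number V E - 1}"

definition NG1_graph :: "'a set \<Rightarrow> 'a set set \<Rightarrow> bool" where
  "NG1_graph V E \<longleftrightarrow> NG_graph V E \<and> clique (ABC_A V E) E"

definition NG2_graph :: "'a set \<Rightarrow> 'a set set \<Rightarrow> bool" where
  "NG2_graph V E \<longleftrightarrow> NG_graph V E \<and> indep (ABC_A V E) E"

definition KS_partition :: "'a set \<Rightarrow> 'a set set \<Rightarrow> 'a set \<Rightarrow> 'a set \<Rightarrow> bool" where
  "KS_partition V E K S \<longleftrightarrow> V = K \<union> S \<and> K \<inter> S = {} \<and> clique K E \<and> indep S E"

definition split_graph :: "'a set \<Rightarrow> 'a set set \<Rightarrow> bool" where
  "split_graph V E \<longleftrightarrow> finite_simple_graph V E \<and> (\<exists>K S. KS_partition V E K S)"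

definition balanced_split_graph :: "'a set \<Rightarrow> 'a set set \<Rightarrow> bool" where
  "balanced_split_graph V E \<longleftrightarrow> split_graph V E \<and>
     (\<exists>K S. KS_partition V E K S \<and>
        card K = clique_number V E \<and> card S = independence_number V E)"

definition unbalanced_split_graph :: "'a set \<Rightarrow> 'a set set \<Rightarrow> bool" where
  "unbalanced_split_graph V E \<longleftrightarrow> split_graph V E \<and> \<not> balanced_split_graph V E"

end

theory Submission
  imports Defs
begin

text \<open>
  A split graph satisfies \<open>\<chi> = \<omega>\<close>, and by complementation the chromatic number of its complement
  is \<open>\<alpha>\<close>; so it is an NG-graph iff \<open>\<omega> + \<alpha> = |V| + 1\<close>. A clique and a stable set share at most one
  vertex, hence \<open>|V| \<le> \<omega> + \<alpha> \<le> |V| + 1\<close>, and the lower value is attained exactly in the balanced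
  case. If \<open>\<omega> + \<alpha> = |V| + 1\<close>, a maximum clique \<open>K\<close> and a maximum stable set \<open>S\<close> cover \<open>V\<close> and meet
  in one vertex \<open>x\<close>. The vertices of \<open>K\<close> in \<open>A\<close> are those without neighbours in \<open>S - {x}\<close>, and the
  vertices of \<open>S\<close> in \<open>A\<close> are those adjacent to all of \<open>K - {x}\<close>, so \<open>A\<close> cannot meet both
  \<open>K - {x}\<close> and \<open>S - {x}\<close>.
\<close>

section \<open>Complements and the duality of cliques and stable sets\<close>

lemma edge_irrefl:
  assumes "finite_simple_graph V E" shows "{v, v} \<notin> E"
  using assms by (auto simp: finite_simple_graph_def nsets_def)

lemma edge_in_vertices:
  assumes "finite_simple_graph V E" "{u, v} \<in> E" shows "u \<in> V" "v \<in> V"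
  using assms by (auto simp: finite_simple_graph_def nsets_def)

lemma finite_simple_graph_complement:
  "finite_simple_graph V E \<Longrightarrow> finite_simple_graph V (complement_edges V E)"
  by (auto simp: finite_simple_graph_def complement_edges_def)

lemma in_complement_edges_iff:
  assumes "u \<in> V" "v \<in> V" "u \<noteq> v"
  shows "{u, v} \<in> complement_edges V E \<longleftrightarrow> {u, v} \<notin> E"
  using assms by (simp add: complement_edges_def nsets_def)

lemma clique_complement:
  assumes "X \<subseteq> V" shows "clique X (complement_edges V E) \<longleftrightarrow> indep X E"
  unfolding clique_def indep_def using assms
  by (auto simp: in_complement_edges_iff subset_iff)

lemma indep_complement:
  assumes "X \<subseteq> V" shows "indep X (complement_edges V E) \<longleftrightarrow> clique X E"
  unfolding clique_def indep_def using assms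
  by (auto simp: in_complement_edges_iff subset_iff)

lemma clique_number_complement:
  "clique_number V (complement_edges V E) = independence_number V E"
proof -
  have "{card K | K. K \<subseteq> V \<and> clique K (complement_edges V E)} = {card S | S. S \<subseteq> V \<and> indep S E}"
    by (auto simp: clique_complement)
  then show ?thesis by (simp add: clique_number_def independence_number_def)
qed

lemma split_graph_complement:
  assumes "split_graph V E" shows "split_graph V (complement_edges V E)"
proof -
  from assms obtain K S where "KS_partition V E K S" and G: "finite_simple_graph V E"
    by (auto simp: split_graph_def)
  then have "KS_partition V (complement_edges V E) S K"
    by (auto simp: KS_partition_def clique_complement indep_complement)
  with G show ?thesis
    by (auto simp: split_graph_def intro: finite_simple_graph_complement)
qed

section \<open>Cliques and stable sets of maximum size\<close>

lemma card_le_clique_number: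
  assumes "finite V" "K \<subseteq> V" "clique K E" shows "card K \<le> clique_number V E"
  unfolding clique_number_def
proof (rule Max_ge)
  show "finite {card K | K. K \<subseteq> V \<and> clique K E}"
    by (rule finite_subset[of _ "card ` Pow V"]) (use assms in auto)
qed (use assms in auto)

lemma maximum_clique:
  assumes "finite V"
  obtains K where "K \<subseteq> V" "clique K E" "card K = clique_number V E"
proof -
  let ?C = "{card K | K. K \<subseteq> V \<and> clique K E}"
  have "finite ?C"
    by (rule finite_subset[of _ "card ` Pow V"]) (use assms in auto)
  \<comment> \<open>The empty clique keeps the set under \<open>Max\<close> nonempty, even for the
    graph without vertices.\<close>
  moreover have "clique {} E" by (simp add: clique_def)
  then have "?C \<noteq> {}" by blast
  ultimately have "Max ?C \<in> ?C" by (rule Max_in)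
  then obtain K where "Max ?C = card K" "K \<subseteq> V" "clique K E" by blast
  then show thesis by (intro that[of K]) (simp_all add: clique_number_def)
qed

text \<open>Stable sets in \<open>V\<close> are cliques of the complement, so the clique bound
  carries over.\<close>

lemma card_le_independence_number:
  assumes "finite V" "S \<subseteq> V" "indep S E" shows "card S \<le> independence_number V E"
  using card_le_clique_number[of V S "complement_edges V E"] assms
  by (simp add: clique_complement clique_number_complement)

lemma maximum_stable_set:
  assumes "finite V"
  obtains S where "S \<subseteq> V" "indep S E" "card S = independence_number V E"
proof -
  obtain S where "S \<subseteq> V" "clique S (complement_edges V E)"
    "card S = clique_number V (complement_edges V E)"
    using assms by (rule maximum_clique)
  then show thesis
    by (intro that[of S]) (simp_all add: clique_complement clique_number_complement)
qed

section \<open>Chromatic number of split graphs\<close>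

lemma clique_card_le_colours:
  assumes "K \<subseteq> V" "clique K E" "proper_colouring V E k c" shows "card K \<le> k"
proof -
  have "inj_on c K"
    using assms unfolding inj_on_def clique_def proper_colouring_def by blast
  moreover have "c ` K \<subseteq> {..<k}"
    using assms by (auto simp: proper_colouring_def)
  ultimately show ?thesis
    by (metis card_inj_on_le card_lessThan finite_lessThan)
qed

text \<open>
  If \<open>K\<close> is a maximum clique, each vertex of \<open>S\<close> reuses the colour of a non-neighbour in \<open>K\<close>;
  otherwise one further colour for \<open>S\<close> is affordable.
\<close>
lemma split_graph_colouring:
  assumes G: "split_graph V E"
  obtains c where "proper_colouring V E (clique_number V E) c"
proof -
  from G obtain K S where KS: "V = K \<union> S" "K \<inter> S = {}" "clique K E" "indep S E"
    and F: "finite_simple_graph V E"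
    by (auto simp: split_graph_def KS_partition_def)
  have fV: "finite V" using F by (simp add: finite_simple_graph_def)
  have fK: "finite K" using fV KS(1) by simp
  from ex_bij_betw_finite_nat[OF fK] obtain f where f: "bij_betw f K {0..<card K}" ..
  have f_less: "f v < card K" if "v \<in> K" for v
    using bij_betwE[OF f] that by simp
  have f_inj: "f u \<noteq> f v" if "u \<in> K" "v \<in> K" "u \<noteq> v" for u v
    using f that by (meson bij_betw_imp_inj_on inj_on_def)
  have le: "card K \<le> clique_number V E"
    using card_le_clique_number fV KS by blast
  have S_stable: "{u, v} \<notin> E" if "u \<in> S" "v \<in> S" for u v
    using that KS(4) edge_irrefl[OF F] unfolding indep_def by (cases "u = v") auto
  have noloop: "u \<noteq> v" if "{u, v} \<in> E" for u v
    using that edge_irrefl[OF F] by metis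
  show thesis
  proof (cases "card K = clique_number V E")
    case True
    have "\<exists>u\<in>K. {u, v} \<notin> E" if v: "v \<in> S" for v
    proof (rule ccontr)
      assume "\<not> ?thesis"
      \<comment> \<open>A vertex of \<open>S\<close> adjacent to all of \<open>K\<close> would
        extend the maximum clique \<open>K\<close>.\<close>
      then have "clique (insert v K) E"
        using KS(3) by (auto simp: clique_def insert_commute)
      then have "card (insert v K) \<le> clique_number V E"
        using v KS(1) fV by (intro card_le_clique_number) auto
      moreover have "v \<notin> K" using v KS(2) by blast
      ultimately show False using True fK by simp
    qed
    then obtain g where g: "\<And>v. v \<in> S \<Longrightarrow> g v \<in> K" "\<And>v. v \<in> S \<Longrightarrow> {g v, v} \<notin> E"
      by metis
    define c where "c v = (if v \<in> K then f v else f (g v))" for v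
    have "proper_colouring V E (clique_number V E) c"
      unfolding proper_colouring_def
    proof (intro conjI ballI impI)
      fix v assume "v \<in> V"
      then show "c v < clique_number V E"
        using KS(1) g(1) f_less True by (auto simp: c_def)
    next
      fix u v assume uv: "u \<in> V" "v \<in> V" "{u, v} \<in> E"
      show "c u \<noteq> c v"
      proof (cases "u \<in> K"; cases "v \<in> K")
        assume "u \<in> K" "v \<in> K"
        then show ?thesis using f_inj noloop[OF uv(3)] by (simp add: c_def)
      next
        assume *: "u \<in> K" "v \<notin> K"
        then have "v \<in> S" using uv KS(1) by blast
        then have "g v \<in> K" "g v \<noteq> u" using g uv(3) by auto
        then show ?thesis using * f_inj by (auto simp: c_def)
      next
        assume *: "u \<notin> K" "v \<in> K"
        then have "u \<in> S" using uv KS(1) by blast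
        then have "g u \<in> K" "g u \<noteq> v" using g uv(3) by (auto simp: insert_commute)
        then show ?thesis using * f_inj by (auto simp: c_def)
      next
        assume "u \<notin> K" "v \<notin> K"
        then show ?thesis using uv KS(1) S_stable by blast
      qed
    qed
    then show thesis by (rule that)
  next
    case False
    \<comment> \<open>The colour \<open>card K\<close> is not a value of \<open>f\<close> on
      \<open>K\<close>, and it is available because \<open>card K\<close> lies strictly below the
      clique number here.\<close>
    define c where "c v = (if v \<in> K then f v else card K)" for v
    have "proper_colouring V E (clique_number V E) c"
      unfolding proper_colouring_def
    proof (intro conjI ballI impI)
      fix v
      show "c v < clique_number V E"
        using f_less[of v] le False by (auto simp: c_def)
    next
      fix u v assume uv: "u \<in> V" "v \<in> V" "{u, v} \<in> E"
      then have "u \<in> K \<or> v \<in> K" using KS(1) S_stable by blast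
      then show "c u \<noteq> c v"
        using f_inj[of u v] noloop[OF uv(3)] f_less[of u] f_less[of v] by (auto simp: c_def)
    qed
    then show thesis by (rule that)
  qed
qed

text \<open>The colouring above gives the upper bound; a maximum clique, whose vertices all need
  different colours, gives the lower one.\<close>

lemma split_graph_chromatic_number:
  assumes "split_graph V E" shows "chromatic_number V E = clique_number V E"
  unfolding chromatic_number_def
proof (rule Least_equality)
  obtain c where "proper_colouring V E (clique_number V E) c"
    using assms by (rule split_graph_colouring)
  then show "\<exists>c. proper_colouring V E (clique_number V E) c" by blast
next
  have "finite V" using assms by (simp add: split_graph_def finite_simple_graph_def)
  then obtain K where K: "K \<subseteq> V" "clique K E" "card K = clique_number V E"
    by (rule maximum_clique)
  show "clique_number V E \<le> k" if "\<exists>c. proper_colouring V E k c" for k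
    using that clique_card_le_colours[OF K(1,2)] by (auto simp: K(3))
qed

lemma split_graph_NG_iff:
  assumes "split_graph V E"
  shows "NG_graph V E \<longleftrightarrow> clique_number V E + independence_number V E = card V + 1"
  unfolding NG_graph_def split_graph_chromatic_number[OF assms]
    split_graph_chromatic_number[OF split_graph_complement[OF assms]] clique_number_complement ..

section \<open>Comparing \<omega> + \<alpha> with |V|\<close>

lemma card_clique_Int_indep:
  assumes "clique K E" "indep S E" shows "card (K \<inter> S) \<le> 1"
proof -
  have "u = v" if "u \<in> K \<inter> S" "v \<in> K \<inter> S" for u v
    using that assms by (auto simp: clique_def indep_def)
  then show ?thesis
    \<comment> \<open>For an infinite set \<open>card\<close> is 0 by convention.\<close>
    by (cases "finite (K \<inter> S)") (auto simp: card_le_Suc0_iff_eq)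
qed

lemma clique_number_plus_independence_number_le:
  assumes "finite V" shows "clique_number V E + independence_number V E \<le> card V + 1"
proof -
  obtain K where K: "K \<subseteq> V" "clique K E" "card K = clique_number V E"
    using assms by (rule maximum_clique)
  obtain S where S: "S \<subseteq> V" "indep S E" "card S = independence_number V E"
    using assms by (rule maximum_stable_set)
  have "card K + card S = card (K \<union> S) + card (K \<inter> S)"
    using K S assms by (meson card_Un_Int finite_subset)
  moreover have "card (K \<union> S) \<le> card V"
    using K S assms by (intro card_mono) auto
  ultimately show ?thesis
    using K S card_clique_Int_indep[OF K(2) S(2)] by linarith
qed

text \<open>The sizes in any KS-partition add up to |V| and are bounded by \<omega> and \<alpha>. If
  \<omega> + \<alpha> = |V|, both bounds are therefore attained, whichever partition was
  chosen.\<close>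

lemma split_graph_balanced_iff:
  assumes "split_graph V E"
  shows "balanced_split_graph V E \<longleftrightarrow> clique_number V E + independence_number V E = card V"
    and "card V \<le> clique_number V E + independence_number V E"
proof -
  have fV: "finite V" using assms by (simp add: split_graph_def finite_simple_graph_def)
  have sum: "card K + card S = card V" if "KS_partition V E K S" for K S
    using that fV by (auto simp: KS_partition_def card_Un_disjoint)
  have le: "card K \<le> clique_number V E" "card S \<le> independence_number V E"
    if "KS_partition V E K S" for K S
    using that fV
    by (auto simp: KS_partition_def intro!: card_le_clique_number card_le_independence_number)
  obtain K S where KS: "KS_partition V E K S" using assms by (auto simp: split_graph_def)
  show "card V \<le> clique_number V E + independence_number V E"
    using sum[OF KS] le[OF KS] by linarith
  show "balanced_split_graph V E \<longleftrightarrow> clique_number V E + independence_number V E = card V"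
  proof
    assume "balanced_split_graph V E"
    then show "clique_number V E + independence_number V E = card V"
      by (auto simp: balanced_split_graph_def dest: sum)
  next
    assume "clique_number V E + independence_number V E = card V"
    then have "card K = clique_number V E" "card S = independence_number V E"
      using sum[OF KS] le[OF KS] by linarith+
    then show "balanced_split_graph V E"
      using KS assms by (auto simp: balanced_split_graph_def)
  qed
qed

lemma split_graph_NG_iff_unbalanced:
  assumes "split_graph V E" shows "NG_graph V E \<longleftrightarrow> unbalanced_split_graph V E"
proof -
  have "finite V" using assms by (simp add: split_graph_def finite_simple_graph_def)
  then show ?thesis
    using clique_number_plus_independence_number_le[of V E] split_graph_balanced_iff[OF assms]
      split_graph_NG_iff[OF assms] assms
    by (auto simp: unbalanced_split_graph_def)
qed

section \<open>Degrees and the structure of the set A\<close>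

lemma vertex_degree_eq_card_neighbours:
  assumes "finite_simple_graph V E" shows "vertex_degree E v = card {w. {v, w} \<in> E}"
proof -
  have "inj_on (\<lambda>w. {v, w}) {w. {v, w} \<in> E}"
    by (auto simp: inj_on_def doubleton_eq_iff)
  moreover have "(\<lambda>w. {v, w}) ` {w. {v, w} \<in> E} = {e \<in> E. v \<in> e}"
  proof -
    have "\<exists>w. e = {v, w}" if "e \<in> E" "v \<in> e" for e
    proof -
      have "card e = 2" using that assms by (auto simp: finite_simple_graph_def nsets_def)
      then show ?thesis using that(2) by (auto simp: card_2_iff)
    qed
    then show ?thesis by auto
  qed
  ultimately show ?thesis
    unfolding vertex_degree_def using card_image by fastforce
qed

lemma NG_split_graph_ABC_A:
  assumes G: "split_graph V E" and NG: "NG_graph V E"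
  shows "clique (ABC_A V E) E \<or> indep (ABC_A V E) E"
proof -
  let ?A = "ABC_A V E" and ?N = "\<lambda>v. {w. {v, w} \<in> E}"
  have F: "finite_simple_graph V E" using G by (simp add: split_graph_def)
  then have fV: "finite V" by (simp add: finite_simple_graph_def)
  obtain K where K: "K \<subseteq> V" "clique K E" "card K = clique_number V E"
    using fV by (rule maximum_clique)
  obtain S where S: "S \<subseteq> V" "indep S E" "card S = independence_number V E"
    using fV by (rule maximum_stable_set)
  have fK: "finite K" using K(1) fV by (rule finite_subset)
  have "card K + card S = card (K \<union> S) + card (K \<inter> S)"
    using K S fV by (meson card_Un_Int finite_subset)
  moreover have "card K + card S = card V + 1"
    using NG K(3) S(3) by (simp add: split_graph_NG_iff[OF G])
  moreover have "card (K \<union> S) \<le> card V"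
    using K S fV by (intro card_mono) auto
  \<comment> \<open>The total |V| + 1 forces equality in both |K \<union> S| \<le> |V| and |K
    \<inter> S| \<le> 1.\<close>
  ultimately have "card (K \<union> S) = card V" and "card (K \<inter> S) = 1"
    using card_clique_Int_indep[OF K(2) S(2)] by linarith+
  then have V: "K \<union> S = V" and "\<exists>x. K \<inter> S = {x}"
    using card_subset_eq[OF fV, of "K \<union> S"] K(1) S(1) by (auto simp: card_1_singleton_iff)
  then obtain x where x: "K \<inter> S = {x}" by blast
  then have "x \<in> K" by blast
  have fN: "finite (?N v)" for v
    by (rule finite_subset[OF _ fV]) (use edge_in_vertices[OF F] in auto)
  \<comment> \<open>Here \<chi> = \<omega> = |K|. This exact count turns the inclusions below into
    equalities of neighbourhoods.\<close>
  have A: "card (?N v) = card K - 1" if "v \<in> ?A" for v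
    using that vertex_degree_eq_card_neighbours[OF F, of v] K(3)
    by (simp add: ABC_A_def split_graph_chromatic_number[OF G])
  have K_nbrs: "?N v = K - {v}" if "v \<in> K" "v \<in> ?A" for v
  proof -
    have "K - {v} \<subseteq> ?N v" using K(2) that(1) by (auto simp: clique_def)
    moreover have "card (K - {v}) = card (?N v)" using A that fK by simp
    ultimately show ?thesis using card_subset_eq[OF fN] by blast
  qed
  have S_nbrs: "?N v = K - {x}" if "v \<in> S" "v \<in> ?A" for v
  proof -
    have "{v, w} \<notin> E" if "w \<in> S" for w
      using that \<open>v \<in> S\<close> S(2) edge_irrefl[OF F] unfolding indep_def by (cases "v = w") auto
    \<comment> \<open>A neighbour of \<open>v\<close> avoids \<open>S\<close>, hence lies in
      \<open>K\<close> and differs from \<open>x\<close>, which belongs to \<open>S\<close>.\<close>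
    then have "?N v \<subseteq> K - {x}"
      using V x edge_in_vertices[OF F] by blast
    moreover have "card (K - {x}) = card (?N v)" using A that fK \<open>x \<in> K\<close> by simp
    ultimately show ?thesis using card_subset_eq[of "K - {x}" "?N v"] fK by simp
  qed
  have AV: "?A \<subseteq> V" by (auto simp: ABC_A_def)
  show ?thesis
  proof (cases "?A \<subseteq> K")
    case True
    then show ?thesis using K(2) by (auto simp: clique_def)
  next
    case False
    then obtain s where s: "s \<in> ?A" "s \<notin> K" by blast
    then have "s \<in> S" using AV V by blast
    then have "?N s = K - {x}" using S_nbrs s(1) by blast
    moreover have "s \<notin> ?N u" if "u \<in> K" "u \<in> ?A" for u
      using K_nbrs[OF that] s(2) by blast
    \<comment> \<open>Any other \<open>u\<close> would lie in \<open>K - {x}\<close>, the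
      neighbourhood of \<open>s\<close>; but all neighbours of \<open>u\<close> are in
      \<open>K\<close> and \<open>s\<close> is not. So A meets \<open>K\<close> at most in
      \<open>x\<close>, which also lies in \<open>S\<close>.\<close>
    ultimately have "u = x" if "u \<in> K" "u \<in> ?A" for u
      using that by (auto simp: insert_commute)
    then have "?A \<subseteq> S" using AV V x by blast
    then show ?thesis using S(2) by (auto simp: indep_def)
  qed
qed

theorem theorem2p3:
  fixes V :: "'a set" and E :: "'a set set"
  assumes "split_graph V E"
  shows "(NG_graph V E \<longleftrightarrow> NG1_graph V E \<or> NG2_graph V E) \<and>
         (NG1_graph V E \<or> NG2_graph V E \<longleftrightarrow> unbalanced_split_graph V E)"
  \<comment> \<open>NG-1 and NG-2 each include NG, so only the passage from NG to one of them uses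
    the structure of A.\<close>
  using NG_split_graph_ABC_A[OF assms] split_graph_NG_iff_unbalanced[OF assms]
  unfolding NG1_graph_def NG2_graph_def by blast

end
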